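(* Let $A:=P\cap S(\gamma)$ be the compact slice and let $\{A_k\}_{k\ge0}$ be a sequence of outer approximations generated by iteratively intersecting the current outer approximation with the supporting halfspaces obtained from the scalarizations $(P_{M_k}(v))$, with symmetric matrices $M_k\succ0$; that is, $A_0\supseteq A$ is a compact polytope and $A_{k+1}=A_k\cap H_{k+1}$, where each generated halfspace $H_{k+1}$ satisfies $A\subseteq H_{k+1}$. Then: (i) (Outer-approximation invariance) For all $k\ge0$, $A\subseteq A_{k+1}\subseteq A_k$. (ii) (Correctness upon Euclidean termination) If for some $\bar k$ one has $\mathrm{err}_2(A_{\bar k},A)\le\varepsilon$, then $A_{\bar k}$ is a Euclidean $\varepsilon$-outer approximation of $A$, i.e., $\delta_H(A_{\bar k},A;\|\cdot\|_2)\le\varepsilon$. (iii) (Sufficient computable stopping test via the adaptive metric) Assume additionally that, for some $\varepsilon_0>0$, $\varepsilon_0 I\preceq M_k\preceq(\varepsilon_0+1)I$ for all $k$. If for some $\bar k$ $$\max_{v\in\operatorname{ext}(A_{\bar k})}\|z^v\|_{M_{\bar k}}\ \le\ \sqrt{\varepsilon_0}\,\varepsilon,$$ where $z^v$ denotes the $z$-part of an optimal solution of $(P_{M_{\bar k}}(v))$, then $\mathrm{err}_2(A_{\bar k},A)\le\varepsilon$, i.e., $\delta_H(A_{\bar k},A;\|\cdot\|_2)\le\varepsilon$.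
   Context: Problem setting. $C\subset\mathbb{R}^q$ is a closed convex cone that is solid (nonempty interior), pointed ($C\cap(-C)=\{0\}$), nontrivial and polyhedral; $C^+=\{w\in\mathbb{R}^q: w^\top y\ge 0\ \forall y\in C\}$, and $y\le_C z$ means $z-y\in C$. $X\subset\mathbb{R}^n$ is nonempty, compact, convex with nonempty interior. $\Gamma:X\to\mathbb{R}^q$ is continuous and $C$-convex: $\Gamma(\lambda x_1+(1-\lambda)x_2)\le_C\lambda\Gamma(x_1)+(1-\lambda)\Gamma(x_2)$ for all $x_1,x_2\in X$, $\lambda\in[0,1]$. $P=\Gamma(X)+C$. Fix $\bar w\in\operatorname{int}C^+$ and $\gamma=\sup_{x\in X}\bar w^\top\Gamma(x)+\alpha$ with $\alpha>0$ large enough that $\Gamma(X)\subset\operatorname{int}S(\gamma)$, where $S(\gamma)=\{y\in\mathbb{R}^q:\bar w^\top y\le\gamma\}$. The slice $A=P\cap S(\gamma)$ is nonempty, convex and compact. Scalarization. For symmetric $M\succ0$ let $\|d\|_M=\sqrt{d^\top Md}$. For $v\in\mathbb{R}^q$, $(P_M(v))$ is: minimize $\|z\|_M$ over $x\in X$, $z\in\mathbb{R}^q$ subject to $\Gamma(x)-z-v\le_C0$ and $\bar w^\top(v+z)\le\gamma$. The halfspace generated from $(P_M(v))$ is $\{y: g^\top y\ge g^\top(v+z)\}$, where $(x,z)$ is primal optimal, $(w,\lambda)\in C^+\times[0,\infty)$ is an optimal Lagrange dual pair (with $w$ the multiplier of the cone constraint and $\lambda$ that of the slice constraint), and $g=w-\lambda\bar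 w$. Notation. $\preceq$ is the Loewner order; $\operatorname{ext}(\cdot)$ is the vertex set; $d_2(v,A)=\inf_{y\in A}\|v-y\|_2$; $\delta_H(\cdot,\cdot;\|\cdot\|_2)$ is the Euclidean Hausdorff distance. The Euclidean outer Hausdorff error is $\mathrm{err}_2(A_k,A):=\delta_H(A_k,A;\|\cdot\|_2)=\max_{v\in\operatorname{ext}(A_k)}d_2(v,A)$. *)

theory Defs
  imports "HOL-Analysis.Analysis"
begin

definition dual_cone :: "'a::real_inner set \<Rightarrow> 'a set" where
  "dual_cone C = {w. \<forall>y\<in>C. 0 \<le> w \<bullet> y}"

definition cone_le :: "'a::real_vector set \<Rightarrow> 'a \<Rightarrow> 'a \<Rightarrow> bool" where
  "cone_le C y z \<longleftrightarrow> z - y \<in> C"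

definition cone_convex_on :: "'b::real_vector set \<Rightarrow> 'a::real_vector set \<Rightarrow> ('a \<Rightarrow> 'b) \<Rightarrow> bool" where
  "cone_convex_on C X \<Gamma> \<longleftrightarrow>
     (\<forall>x1\<in>X. \<forall>x2\<in>X. \<forall>l\<in>{0..1}.
        cone_le C (\<Gamma> (l *\<^sub>R x1 + (1 - l) *\<^sub>R x2)) (l *\<^sub>R \<Gamma> x1 + (1 - l) *\<^sub>R \<Gamma> x2))"

definition slice_halfspace :: "'a::real_inner \<Rightarrow> real \<Rightarrow> 'a set" where
  "slice_halfspace wb \<gamma> = {y. wb \<bullet> y \<le> \<gamma>}"

text \<open>Here \<open>+\<close> is the Minkowski sum of sets.\<close>

definition upper_image :: "'b::real_vector set \<Rightarrow> 'a set \<Rightarrow> ('a \<Rightarrow> 'b) \<Rightarrow> 'b set" where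
  "upper_image C X \<Gamma> = \<Gamma> ` X + C"

definition slice :: "'b::real_inner set \<Rightarrow> 'a set \<Rightarrow> ('a \<Rightarrow> 'b) \<Rightarrow> 'b \<Rightarrow> real \<Rightarrow> 'b set" where
  "slice C X \<Gamma> wb \<gamma> = upper_image C X \<Gamma> \<inter> slice_halfspace wb \<gamma>"

definition pos_def :: "real^'q^'q \<Rightarrow> bool" where
  "pos_def M \<longleftrightarrow> transpose M = M \<and> (\<forall>x. x \<noteq> 0 \<longrightarrow> 0 < x \<bullet> (M *v x))"

definition pos_semidef :: "real^'q^'q \<Rightarrow> bool" where
  "pos_semidef M \<longleftrightarrow> transpose M = M \<and> (\<forall>x. 0 \<le> x \<bullet> (M *v x))"

definition loewner_le :: "real^'q^'q \<Rightarrow> real^'q^'q \<Rightarrow> bool" where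
  "loewner_le M N \<longleftrightarrow> pos_semidef (N - M)"

definition mnorm :: "real^'q^'q \<Rightarrow> real^'q \<Rightarrow> real" where
  "mnorm M d = sqrt (d \<bullet> (M *v d))"

definition scal_feasible ::
  "(real^'q) set \<Rightarrow> (real^'n) set \<Rightarrow> (real^'n \<Rightarrow> real^'q) \<Rightarrow> real^'q \<Rightarrow> real \<Rightarrow> real^'q \<Rightarrow>
   (real^'n) \<times> (real^'q) \<Rightarrow> bool" where
  "scal_feasible C X \<Gamma> wb \<gamma> v = (\<lambda>(x, z).
     x \<in> X \<and> cone_le C (\<Gamma> x - z - v) 0 \<and> wb \<bullet> (v + z) \<le> \<gamma>)"

definition scal_optimal ::
  "(real^'q) set \<Rightarrow> (real^'n) set \<Rightarrow> (real^'n \<Rightarrow> real^'q) \<Rightarrow> real^'q \<Rightarrow> real \<Rightarrow> real^'q^'q \<Rightarrow>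
   real^'q \<Rightarrow> (real^'n) \<times> (real^'q) \<Rightarrow> bool" where
  "scal_optimal C X \<Gamma> wb \<gamma> M v p \<longleftrightarrow>
     is_arg_min (\<lambda>(x, z). mnorm M z) (scal_feasible C X \<Gamma> wb \<gamma> v) p"

definition scal_lagrangian ::
  "(real^'n \<Rightarrow> real^'q) \<Rightarrow> real^'q \<Rightarrow> real \<Rightarrow> real^'q^'q \<Rightarrow> real^'q \<Rightarrow>
   (real^'n) \<times> (real^'q) \<Rightarrow> (real^'q) \<times> real \<Rightarrow> real" where
  "scal_lagrangian \<Gamma> wb \<gamma> M v = (\<lambda>(x, z) (w, l).
     mnorm M z + w \<bullet> (\<Gamma> x - z - v) + l * (wb \<bullet> (v + z) - \<gamma>))"

text \<open>The dual function may take the value \<open>-\<infinity>\<close>, hence the extended reals.\<close>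

definition scal_dual_fun ::
  "(real^'n) set \<Rightarrow> (real^'n \<Rightarrow> real^'q) \<Rightarrow> real^'q \<Rightarrow> real \<Rightarrow> real^'q^'q \<Rightarrow> real^'q \<Rightarrow>
   (real^'q) \<times> real \<Rightarrow> ereal" where
  "scal_dual_fun X \<Gamma> wb \<gamma> M v d =
     (INF p\<in>X \<times> UNIV. ereal (scal_lagrangian \<Gamma> wb \<gamma> M v p d))"

definition scal_dual_optimal ::
  "(real^'q) set \<Rightarrow> (real^'n) set \<Rightarrow> (real^'n \<Rightarrow> real^'q) \<Rightarrow> real^'q \<Rightarrow> real \<Rightarrow> real^'q^'q \<Rightarrow>
   real^'q \<Rightarrow> (real^'q) \<times> real \<Rightarrow> bool" where
  "scal_dual_optimal C X \<Gamma> wb \<gamma> M v d \<longleftrightarrow>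
     is_arg_max (scal_dual_fun X \<Gamma> wb \<gamma> M v) (\<lambda>d. d \<in> dual_cone C \<times> {0..}) d"

definition generated_halfspace ::
  "(real^'q) set \<Rightarrow> (real^'n) set \<Rightarrow> (real^'n \<Rightarrow> real^'q) \<Rightarrow> real^'q \<Rightarrow> real \<Rightarrow> real^'q^'q \<Rightarrow>
   real^'q \<Rightarrow> (real^'q) set \<Rightarrow> bool" where
  "generated_halfspace C X \<Gamma> wb \<gamma> M v H \<longleftrightarrow>
     (\<exists>x z w l. scal_optimal C X \<Gamma> wb \<gamma> M v (x, z) \<and>
        scal_dual_optimal C X \<Gamma> wb \<gamma> M v (w, l) \<and>
        (let g = w - l *\<^sub>R wb in H = {y. g \<bullet> y \<ge> g \<bullet> (v + z)}))"

definition vertices :: "'a::real_vector set \<Rightarrow> 'a set" where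
  "vertices S = {v. v extreme_point_of S}"

text \<open>The suprema are those of the reals, so this is the Hausdorff distance for nonempty
  bounded sets only.\<close>

definition hausdorff_dist :: "'a::metric_space set \<Rightarrow> 'a set \<Rightarrow> real" where
  "hausdorff_dist S T = max (SUP s\<in>S. infdist s T) (SUP t\<in>T. infdist t S)"

definition err2 :: "'a::euclidean_space set \<Rightarrow> 'a set \<Rightarrow> real" where
  "err2 B A = hausdorff_dist B A"

definition euclidean_outer_approx :: "real \<Rightarrow> 'a::euclidean_space set \<Rightarrow> 'a set \<Rightarrow> bool" where
  "euclidean_outer_approx \<epsilon> B A \<longleftrightarrow> A \<subseteq> B \<and> hausdorff_dist B A \<le> \<epsilon>"

lemma convex_on_infdist:
  fixes A :: "'a::euclidean_space set"
  assumes "convex A" "closed A" "A \<noteq> {}"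
  shows "convex_on UNIV (\<lambda>x. infdist x A)"
proof (rule convex_onI)
  fix t :: real and x y :: 'a
  assume t: "0 < t" "t < 1"
  obtain a where a: "a \<in> A" "infdist x A = dist x a"
    using infdist_attains_inf[OF assms(2,3)] by blast
  obtain b where b: "b \<in> A" "infdist y A = dist y b"
    using infdist_attains_inf[OF assms(2,3)] by blast
  have "(1 - t) *\<^sub>R a + t *\<^sub>R b \<in> A"
    using assms(1) a b t by (simp add: convex_alt)
  then have "infdist ((1 - t) *\<^sub>R x + t *\<^sub>R y) A
      \<le> dist ((1 - t) *\<^sub>R x + t *\<^sub>R y) ((1 - t) *\<^sub>R a + t *\<^sub>R b)"
    by (rule infdist_le)
  also have "\<dots> = norm ((1 - t) *\<^sub>R (x - a) + t *\<^sub>R (y - b))"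
    by (simp add: dist_norm algebra_simps)
  also have "\<dots> \<le> norm ((1 - t) *\<^sub>R (x - a)) + norm (t *\<^sub>R (y - b))"
    by (rule norm_triangle_ineq)
  also have "\<dots> = (1 - t) * infdist x A + t * infdist y A"
    using t a b by (simp add: dist_norm)
  finally show "infdist ((1 - t) *\<^sub>R x + t *\<^sub>R y) A \<le> (1 - t) * infdist x A + t * infdist y A" .
qed simp

lemma err2_eq_Max_vertices:
  fixes A B :: "'a::euclidean_space set"
  assumes A: "convex A" "closed A" "A \<noteq> {}" and B: "polytope B" and "A \<subseteq> B"
  shows "err2 B A = Max ((\<lambda>v. infdist v A) ` vertices B)"
proof -
  let ?f = "\<lambda>v. infdist v A"
  let ?m = "Max (?f ` vertices B)"
  have fin: "finite (vertices B)"
    using finite_polyhedron_extreme_points[OF polytope_imp_polyhedron[OF B]]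
    by (simp add: vertices_def)
  have hull: "B = convex hull (vertices B)"
    using Krein_Milman_Minkowski[OF polytope_imp_compact[OF B] polytope_imp_convex[OF B]]
    by (simp add: vertices_def)
  have "B \<noteq> {}" using assms by blast
  then have ne: "vertices B \<noteq> {}" using hull by auto
  have sub: "vertices B \<subseteq> B" by (auto simp: vertices_def extreme_point_of_def)
  have cvx: "convex_on (convex hull (vertices B)) ?f"
    using convex_on_infdist[OF A] by (rule convex_on_subset) (auto simp: convex_convex_hull)
  have "\<forall>x\<in>convex hull (vertices B). ?f x \<le> ?m"
    by (rule convex_on_convex_hull_bound[OF cvx]) (use fin in auto)
  then have le: "?f x \<le> ?m" if "x \<in> B" for x using that hull by simp
  have "?m \<in> ?f ` vertices B" using fin ne by (intro Max_in) auto
  then have "?m \<in> ?f ` B" using sub by auto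
  then have 1: "(SUP b\<in>B. infdist b A) = ?m"
    by (rule cSup_eq_maximum) (use le in auto)
  have "infdist a B = 0" if "a \<in> A" for a using that assms by auto
  then have 2: "(SUP a\<in>A. infdist a B) = 0" using A by simp
  have "0 \<le> ?m" using \<open>?m \<in> ?f ` B\<close> infdist_nonneg by auto
  then show ?thesis unfolding err2_def hausdorff_dist_def 1 2 by simp
qed

end

theory Submission
  imports Defs
begin

text \<open>If \<open>(x, z)\<close> is feasible for the scalarization at \<open>v\<close>, then \<open>v + z\<close> lies in the
  slice, so the Euclidean distance from \<open>v\<close> to the slice is at most the norm of \<open>z\<close>, and the
  lower Loewner bound controls that norm by the adaptive one. The Hausdorff error is attained at
  a vertex because the distance to a convex set is a convex function.\<close>

text \<open>The defect in the convexity inequality for \<Gamma> lies in \<open>C\<close>, and a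
  convex cone is closed under addition, so the defect can be absorbed into the cone summand.\<close>

lemma convex_upper_image:
  assumes "cone_convex_on C X \<Gamma>" "convex X" "convex C" "cone C"
  shows "convex (upper_image C X \<Gamma>)"
proof (rule convexI)
  fix a b and u w :: real
  assume ab: "a \<in> upper_image C X \<Gamma>" "b \<in> upper_image C X \<Gamma>"
    and uw: "0 \<le> u" "0 \<le> w" "u + w = 1"
  obtain x c where x: "x \<in> X" "c \<in> C" "a = \<Gamma> x + c"
    using ab(1) by (auto simp: upper_image_def set_plus_def)
  obtain y d where y: "y \<in> X" "d \<in> C" "b = \<Gamma> y + d"
    using ab(2) by (auto simp: upper_image_def set_plus_def)
  have w: "w = 1 - u" using uw by simp
  let ?p = "u *\<^sub>R x + w *\<^sub>R y"
  \<comment> \<open>The cone part of the combined point: the convexity defect of \<Gamma> plus the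
    combination of the two given cone parts.\<close>
  let ?e = "(u *\<^sub>R \<Gamma> x + w *\<^sub>R \<Gamma> y - \<Gamma> ?p) + (u *\<^sub>R c + w *\<^sub>R d)"
  have "?p \<in> X" using convexD[OF assms(2) x(1) y(1) uw] .
  moreover have "u *\<^sub>R \<Gamma> x + w *\<^sub>R \<Gamma> y - \<Gamma> ?p \<in> C"
    using assms(1) x(1) y(1) uw unfolding cone_convex_on_def cone_le_def w by auto
  then have "?e \<in> C"
    using convexD[OF assms(3) x(2) y(2) uw] assms(3,4) convex_cone by blast
  moreover have "u *\<^sub>R a + w *\<^sub>R b = \<Gamma> ?p + ?e"
    using x y by (simp add: algebra_simps)
  ultimately show "u *\<^sub>R a + w *\<^sub>R b \<in> upper_image C X \<Gamma>"
    unfolding upper_image_def by (metis image_eqI set_plus_intro)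
qed

text \<open>The continuous image of \<open>X\<close> is compact, and a compact set plus a closed set
  is closed.\<close>

lemma closed_upper_image:
  fixes C :: "'b::real_normed_vector set" and X :: "'a::real_normed_vector set"
  assumes "compact X" "continuous_on X \<Gamma>" "closed C"
  shows "closed (upper_image C X \<Gamma>)"
proof -
  have "upper_image C X \<Gamma> = (\<Union>a\<in>\<Gamma> ` X. \<Union>c\<in>C. {a + c})"
    unfolding upper_image_def set_plus_def by auto
  then show ?thesis
    using compact_closed_sums[OF compact_continuous_image[OF assms(2,1)] assms(3)] by simp
qed

lemma slice_halfspace_closed_convex:
  "closed (slice_halfspace wb \<gamma>)" "convex (slice_halfspace wb \<gamma>)"
  unfolding slice_halfspace_def by (rule closed_halfspace_le convex_halfspace_le)+

text \<open>The cone constraint says that \<open>v + z\<close> exceeds \<open>\<Gamma> x\<close> by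
  an element of \<open>C\<close>; the other constraint is membership in the slicing
  halfspace.\<close>

lemma scal_feasible_slice:
  assumes "scal_feasible C X \<Gamma> wb \<gamma> v (x, z)"
  shows "v + z \<in> slice C X \<Gamma> wb \<gamma>"
proof -
  have "x \<in> X" "v + z - \<Gamma> x \<in> C" "wb \<bullet> (v + z) \<le> \<gamma>"
    using assms by (auto simp: scal_feasible_def cone_le_def algebra_simps)
  moreover have "v + z = \<Gamma> x + (v + z - \<Gamma> x)" by simp
  ultimately show ?thesis
    unfolding slice_def upper_image_def slice_halfspace_def
    by (metis (mono_tags, lifting) IntI image_eqI mem_Collect_eq set_plus_intro)
qed

lemma infdist_slice_le_norm:
  assumes "scal_optimal C X \<Gamma> wb \<gamma> M v (x, z)"
  shows "infdist v (slice C X \<Gamma> wb \<gamma>) \<le> norm z"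
proof -
  have "scal_feasible C X \<Gamma> wb \<gamma> v (x, z)"
    using assms by (simp add: scal_optimal_def is_arg_min_def)
  from infdist_le[OF scal_feasible_slice[OF this], of v] show ?thesis
    by (simp add: dist_norm)
qed

text \<open>Evaluate the semidefinite form of \<open>M - e *\<^sub>R mat 1\<close> at
  \<open>z\<close> and take roots; \<open>sqrt\<close> is monotone and multiplicative on all reals,
  so \<open>e\<close> may have any sign.\<close>

lemma norm_le_mnorm:
  assumes "loewner_le (e *\<^sub>R mat 1) M"
  shows "sqrt e * norm z \<le> mnorm M z"
proof -
  have "0 \<le> z \<bullet> ((M - e *\<^sub>R mat 1) *v z)"
    using assms by (auto simp: loewner_le_def pos_semidef_def)
  then have "e * (norm z)\<^sup>2 \<le> z \<bullet> (M *v z)"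
    by (simp add: matrix_vector_mult_diff_rdistrib scaleR_matrix_vector_assoc[symmetric]
        inner_diff_right power2_norm_eq_inner)
  then have "sqrt (e * (norm z)\<^sup>2) \<le> mnorm M z"
    unfolding mnorm_def by (rule real_sqrt_le_mono)
  then show ?thesis by (simp add: real_sqrt_mult)
qed

text \<open>Ensures that each cut of a polytope is again a polytope. A zero normal is harmless: the
  set is then the whole space, still a polyhedron.\<close>

lemma polyhedron_generated_halfspace:
  assumes "generated_halfspace C X \<Gamma> wb \<gamma> M v H"
  shows "polyhedron H"
  using assms polyhedron_halfspace_ge by (auto simp: generated_halfspace_def Let_def)

theorem theorem10:
  fixes C :: "(real^'q) set" and X :: "(real^'n) set" and \<Gamma> :: "real^'n \<Rightarrow> real^'q"
    and wb :: "real^'q" and \<alpha> \<gamma> :: real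
    and M :: "nat \<Rightarrow> real^'q^'q" and A H :: "nat \<Rightarrow> (real^'q) set"
  assumes C: "closed C" "convex C" "cone C" "interior C \<noteq> {}" "C \<inter> uminus ` C = {0}"
      "C \<noteq> {0}" "C \<noteq> UNIV" "polyhedron C"
    and X: "X \<noteq> {}" "compact X" "convex X" "interior X \<noteq> {}"
    and \<Gamma>: "continuous_on X \<Gamma>" "cone_convex_on C X \<Gamma>"
    and wb: "wb \<in> interior (dual_cone C)"
    and \<gamma>: "\<gamma> = (SUP x\<in>X. wb \<bullet> \<Gamma> x) + \<alpha>" "\<alpha> > 0"
      "\<Gamma> ` X \<subseteq> interior (slice_halfspace wb \<gamma>)"
    and M: "\<And>k. pos_def (M k)"
    and A0: "polytope (A 0)" "slice C X \<Gamma> wb \<gamma> \<subseteq> A 0"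
    and step: "\<And>k. A (Suc k) = A k \<inter> H (Suc k)"
      "\<And>k. \<exists>v. generated_halfspace C X \<Gamma> wb \<gamma> (M k) v (H (Suc k))"
      "\<And>k. slice C X \<Gamma> wb \<gamma> \<subseteq> H (Suc k)"
  shows "(\<forall>k. slice C X \<Gamma> wb \<gamma> \<subseteq> A (Suc k) \<and> A (Suc k) \<subseteq> A k) \<and>
    (\<forall>\<epsilon> k. err2 (A k) (slice C X \<Gamma> wb \<gamma>) \<le> \<epsilon> \<longrightarrow>
       euclidean_outer_approx \<epsilon> (A k) (slice C X \<Gamma> wb \<gamma>)) \<and>
    (\<forall>\<epsilon>0>0. (\<forall>k. loewner_le (\<epsilon>0 *\<^sub>R mat 1) (M k) \<and> loewner_le (M k) ((\<epsilon>0 + 1) *\<^sub>R mat 1)) \<longrightarrow>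
       (\<forall>\<epsilon> k zv.
          (\<forall>v\<in>vertices (A k). \<exists>x. scal_optimal C X \<Gamma> wb \<gamma> (M k) v (x, zv v)) \<longrightarrow>
          Max ((\<lambda>v. mnorm (M k) (zv v)) ` vertices (A k)) \<le> sqrt \<epsilon>0 * \<epsilon> \<longrightarrow>
          err2 (A k) (slice C X \<Gamma> wb \<gamma>) \<le> \<epsilon> \<and>
          hausdorff_dist (A k) (slice C X \<Gamma> wb \<gamma>) \<le> \<epsilon>))"
proof -
  let ?S = "slice C X \<Gamma> wb \<gamma>"
  have conv: "convex ?S" and clo: "closed ?S"
    unfolding slice_def
    by (intro convex_Int closed_Int convex_upper_image closed_upper_image
        slice_halfspace_closed_convex C X \<Gamma>)+
  obtain x where x: "x \<in> X" using X(1) by blast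
  \<comment> \<open>Here \<open>0\<close> belongs to \<open>C\<close> by pointedness,
    \<open>C(5)\<close>.\<close>
  have "\<Gamma> x + 0 \<in> upper_image C X \<Gamma>"
    unfolding upper_image_def using x C(5) by (intro set_plus_intro) auto
  moreover have "\<Gamma> x \<in> slice_halfspace wb \<gamma>"
    using \<gamma>(3) x interior_subset by blast
  ultimately have ne: "?S \<noteq> {}" by (auto simp: slice_def)
  have sub: "?S \<subseteq> A k" for k
    by (induction k) (use A0 step in auto)
  \<comment> \<open>Makes the vertex set of every iterate finite with the iterate as its convex
    hull, as the vertex formula for \<open>err2\<close> requires.\<close>
  have poly: "polytope (A k)" for k
  proof (induction k)
    case (Suc k)
    show ?case
      using Suc step(1,2)[of k] polytope_Int_polyhedron polyhedron_generated_halfspace by metis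
  qed (rule A0)
  have "err2 (A k) ?S \<le> \<epsilon>"
    if "\<epsilon>0 > 0" "\<forall>k. loewner_le (\<epsilon>0 *\<^sub>R mat 1) (M k)"
      and opt: "\<forall>v\<in>vertices (A k). \<exists>x. scal_optimal C X \<Gamma> wb \<gamma> (M k) v (x, zv v)"
      and le: "Max ((\<lambda>v. mnorm (M k) (zv v)) ` vertices (A k)) \<le> sqrt \<epsilon>0 * \<epsilon>"
    for \<epsilon>0 \<epsilon> k zv
  proof -
    have fin: "finite (vertices (A k))"
      using finite_polyhedron_extreme_points[OF polytope_imp_polyhedron[OF poly]]
      by (simp add: vertices_def)
    have "A k = convex hull (vertices (A k))"
      using Krein_Milman_Minkowski[OF polytope_imp_compact[OF poly] polytope_imp_convex[OF poly]]
      by (simp add: vertices_def)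
    \<comment> \<open>Without vertices the hull \<open>A k\<close> would be empty, yet it contains
      the nonempty slice. Nonemptiness is what lets \<open>Max\<close> be bounded
      elementwise.\<close>
    then have vne: "vertices (A k) \<noteq> {}" using ne sub[of k] by auto
    have "infdist v ?S \<le> \<epsilon>" if v: "v \<in> vertices (A k)" for v
    proof -
      have "sqrt \<epsilon>0 * norm (zv v) \<le> mnorm (M k) (zv v)"
        using norm_le_mnorm \<open>\<forall>k. loewner_le _ _\<close> by blast
      also have "\<dots> \<le> sqrt \<epsilon>0 * \<epsilon>"
        using le Max_ge[OF finite_imageI[OF fin] imageI[OF v]] by (rule order_trans[rotated])
      \<comment> \<open>Cancel the positive factor \<open>sqrt \<epsilon>0\<close>, the constant
        built into the stopping threshold.\<close>
      finally have "norm (zv v) \<le> \<epsilon>" using \<open>\<epsilon>0 > 0\<close> by simp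
      then show ?thesis using opt v infdist_slice_le_norm by (meson order_trans)
    qed
    then show ?thesis
      unfolding err2_eq_Max_vertices[OF conv clo ne poly sub] using fin vne by simp
  qed
  \<comment> \<open>The first two claims follow from \<open>sub\<close> and the cutting step, since
    \<open>err2\<close> is the Hausdorff distance by definition.\<close>
  then show ?thesis
    using sub step(1) unfolding euclidean_outer_approx_def err2_def by blast
qed

end
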